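(* Let $q,p_1,p_2$ be pairwise relatively co-prime positive integers and set $M_1=qp_1$, $M_2=qp_2$, $M_3=p_1p_2$. Let sensors be located at the positions $\{m_1M_1,\ m_2M_2,\ m_3M_3 \mid m_1\in\{0,1,\dots,2p_2-1\},\ m_2\in\{0,1,\dots,p_1-1\},\ m_3\in\{0,1,\dots,q-1\}\}$, forming three uniform subarrays. Then the difference set $$\{\pm(m_1M_1-m_2M_2)\pm m_3M_3 \mid m_1\in\{0,\dots,2p_2-1\},\ m_2\in\{0,\dots,p_1-1\},\ m_3\in\{0,\dots,q-1\}\}$$ (with the two signs chosen independently) contains every integer from $-p_1p_2q$ to $p_1p_2q$.
   Context: Sensor positions and lags are measured in units of $d=\lambda/2$, where $\lambda$ is the wavelength, so they are integers. "Consecutive lags" from $-p_1p_2q$ to $p_1p_2q$ means all integers in that range. *)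

theory Defs
  imports Main
begin

end

theory Submission imports Defs begin

text \<open>
  By symmetry consider \<open>0 \<le> k \<le> p1 * p2 * q\<close>. Choose \<open>m3 < q\<close> with
  \<open>m3 * p1 * p2 \<equiv> k\<close> modulo \<open>q\<close>; then \<open>k - m3 * p1 * p2 = q * n\<close> with \<open>\<bar>n\<bar> \<le> p1 * p2\<close>.
  Choosing \<open>m2 < p1\<close> with \<open>m2 * p2 \<equiv> - \<bar>n\<bar>\<close> modulo \<open>p1\<close> gives \<open>\<bar>n\<bar> = m1 * p1 - m2 * p2\<close>,
  where \<open>0 \<le> m1 * p1 < 2 * p1 * p2\<close>. The sign of \<open>n\<close> is absorbed by the first free sign.
\<close>

text \<open>A Bezout coefficient \<open>u\<close> of \<open>a\<close> is an inverse of
  \<open>a\<close> modulo \<open>p\<close>, so \<open>u * n\<close> reduced modulo \<open>p\<close>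
  is the required residue.\<close>

lemma coprime_residue_solution:
  fixes a p n :: int
  assumes "p > 0" and "coprime a p"
  obtains m where "m \<in> {0..p - 1}" and "p dvd n - m * a"
proof -
  obtain u v where uv: "u * a + v * p = 1"
    using bezout_int[of a p] assms(2) by auto
  define m where "m = (u * n) mod p"
  have "n - m * a = n * (u * a + v * p) - m * a"
    using uv by simp
  also have "\<dots> = (u * n - m) * a + p * (n * v)"
    by (simp add: algebra_simps)
  finally have "p dvd n - m * a"
    by (simp add: m_def dvd_minus_mod)
  moreover have "m \<in> {0..p - 1}"
    using assms(1) by (simp add: m_def)
  ultimately show thesis using that by blast
qed

lemma coprime_pair_difference:
  fixes p1 p2 n :: int
  assumes "p1 > 0" and "p2 > 0" and "coprime p1 p2" and "0 \<le> n" and "n \<le> p1 * p2"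
  obtains m1 m2 where "m1 \<in> {0..2 * p2 - 1}" and "m2 \<in> {0..p1 - 1}"
    and "n = m1 * p1 - m2 * p2"
proof -
  have "coprime p2 p1"
    using assms(3) by (simp add: coprime_commute)
  then obtain m2 where m2: "m2 \<in> {0..p1 - 1}" and "p1 dvd - n - m2 * p2"
    using coprime_residue_solution[OF assms(1)] by blast
  then have "p1 dvd n + m2 * p2"
    by (metis dvd_minus_iff minus_add_distrib uminus_add_conv_diff add.commute)
  then obtain m1 where m1: "n + m2 * p2 = p1 * m1" ..
  have "0 \<le> p1 * m1"
    using m1[symmetric] m2 assms by simp
  \<comment> \<open>Adding this to \<open>n \<le> p1 * p2\<close> gives less than
    \<open>2 * (p1 * p2)\<close>: hence the doubled range of \<open>m1\<close>. Strictness, from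
    \<open>m2 \<le> p1 - 1\<close>, excludes \<open>m1 = 2 * p2\<close>.\<close>
  moreover have "m2 * p2 < p1 * p2"
    using m2 assms(2) by simp
  then have "p1 * m1 < p1 * (2 * p2)"
    using m1 assms(5) by linarith
  ultimately have "m1 \<in> {0..2 * p2 - 1}"
    using assms(1) by (simp add: zero_le_mult_iff)
  moreover have "n = m1 * p1 - m2 * p2"
    using m1 by (simp add: algebra_simps)
  ultimately show thesis using that m2 by blast
qed

text \<open>For nonnegative lags the \<open>m3\<close> term can always carry a plus sign, which
  leaves the second free sign for negative lags.\<close>

lemma three_subarray_lag:
  fixes q p1 p2 k :: int
  assumes "q > 0" and "p1 > 0" and "p2 > 0"
    and "coprime q p1" and "coprime q p2" and "coprime p1 p2"
    and "0 \<le> k" and "k \<le> p1 * p2 * q"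
  obtains s m1 m2 m3 where "s \<in> {1, - 1}" and "m1 \<in> {0..2 * p2 - 1}"
    and "m2 \<in> {0..p1 - 1}" and "m3 \<in> {0..q - 1}"
    and "k = s * (m1 * (q * p1) - m2 * (q * p2)) + m3 * (p1 * p2)"
proof -
  have "coprime (p1 * p2) q"
    using assms(4,5) by (simp add: coprime_commute)
  then obtain m3 where m3: "m3 \<in> {0..q - 1}" and "q dvd k - m3 * (p1 * p2)"
    using coprime_residue_solution[OF assms(1)] by blast
  then obtain n where n: "k - m3 * (p1 * p2) = q * n" by blast
  have P: "0 < p1 * p2"
    using assms(2,3) by simp
  have "0 \<le> m3 * (p1 * p2)" and "m3 * (p1 * p2) \<le> q * (p1 * p2)"
    using m3 P by (auto intro: mult_right_mono)
  \<comment> \<open>Both \<open>k\<close> and \<open>m3 * (p1 * p2)\<close> lie between 0 and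
    \<open>q * (p1 * p2)\<close>, so their difference \<open>q * n\<close> is at most this bound in
    absolute value.\<close>
  then have "q * n \<le> q * (p1 * p2)" and "q * (- n) \<le> q * (p1 * p2)"
    using n assms(7,8) by (simp_all add: algebra_simps)
  then have "\<bar>n\<bar> \<le> p1 * p2"
    using mult_le_cancel_left_pos[OF assms(1)] by (metis abs_le_iff)
  then obtain m1 m2 where m: "m1 \<in> {0..2 * p2 - 1}" "m2 \<in> {0..p1 - 1}"
    and abs_n: "\<bar>n\<bar> = m1 * p1 - m2 * p2"
    using coprime_pair_difference[OF assms(2,3,6)] by (metis abs_ge_zero)
  define s :: int where "s = (if n \<ge> 0 then 1 else - 1)"
  have "s \<in> {1, - 1}" and "n = s * \<bar>n\<bar>"
    by (simp_all add: s_def)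
  then have "k = q * (s * (m1 * p1 - m2 * p2)) + m3 * (p1 * p2)"
    using n abs_n by simp
  then have "k = s * (m1 * (q * p1) - m2 * (q * p2)) + m3 * (p1 * p2)"
    by (simp add: algebra_simps)
  with \<open>s \<in> {1, - 1}\<close> m m3 show thesis using that by blast
qed

theorem theorem3:
  fixes q p1 p2 M1 M2 M3 :: int and sensors differences :: "int set"
  assumes "q > 0" and "p1 > 0" and "p2 > 0"
    and "coprime q p1" and "coprime q p2" and "coprime p1 p2"
    and "M1 = q * p1" and "M2 = q * p2" and "M3 = p1 * p2"
    and "sensors = {m1 * M1 | m1. m1 \<in> {0..2 * p2 - 1}}
                 \<union> {m2 * M2 | m2. m2 \<in> {0..p1 - 1}}
                 \<union> {m3 * M3 | m3. m3 \<in> {0..q - 1}}"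
    and "differences = {s * (m1 * M1 - m2 * M2) + t * (m3 * M3) | s t m1 m2 m3.
                          s \<in> {1, - 1} \<and> t \<in> {1, - 1} \<and>
                          m1 \<in> {0..2 * p2 - 1} \<and> m2 \<in> {0..p1 - 1} \<and> m3 \<in> {0..q - 1}}"
  shows "{- (p1 * p2 * q)..p1 * p2 * q} \<subseteq> differences"
proof
  fix k assume "k \<in> {- (p1 * p2 * q)..p1 * p2 * q}"
  then have "\<bar>k\<bar> \<le> p1 * p2 * q" by auto
  then obtain s m1 m2 m3 where s: "s \<in> {1, - 1}"
    and m: "m1 \<in> {0..2 * p2 - 1}" "m2 \<in> {0..p1 - 1}" "m3 \<in> {0..q - 1}"
    and abs_k: "\<bar>k\<bar> = s * (m1 * M1 - m2 * M2) + m3 * M3"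
    using three_subarray_lag[OF assms(1-6) abs_ge_zero] assms(7-9) by metis
  \<comment> \<open>Multiplying the representation of \<open>\<bar>k\<bar>\<close> by the sign of
    \<open>k\<close> turns the two signs \<open>s\<close> and 1 into \<open>t * s\<close> and
    \<open>t\<close>.\<close>
  define t :: int where "t = (if k \<ge> 0 then 1 else - 1)"
  have t: "t \<in> {1, - 1}" and "k = t * \<bar>k\<bar>"
    by (simp_all add: t_def)
  then have "k = (t * s) * (m1 * M1 - m2 * M2) + t * (m3 * M3)"
    using abs_k by (simp add: algebra_simps)
  moreover have "t * s \<in> {1, - 1}"
    using s t by auto
  ultimately show "k \<in> differences"
    unfolding assms(11) using m t by blast
qed

end
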